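(* Let $y = f + \varepsilon$, where $f \in \mathbb{R}^n$ is fixed and $\varepsilon$ has i.i.d. zero-mean sub-Gaussian entries with parameter $\sigma$. Define $$\mathcal{E}^* = \min_{\beta\succeq 0}\frac{1}{n}\|X\beta - f\|_2^2, \qquad \widehat{\mathcal{E}} = \frac{1}{n}\|X\widehat{\beta} - f\|_2^2 .$$ Suppose that $X$ has the self-regularizing property with constant $\tau>0$ (see context). Then, for any minimizer $\widehat{\beta}$ of the non-negative least squares problem $\min_{\beta\succeq 0}\frac{1}{n}\|y - X\beta\|_2^2$ and any $M\ge 0$, it holds with probability no less than $1 - 2p^{-M^2}$ that $$\widehat{\mathcal{E}} \le \mathcal{E}^* + \left(\frac{6\|\beta^*\|_1 + 8\sqrt{\mathcal{E}^*}}{\tau^2}\right)(1+M)\,\sigma\sqrt{\frac{2\log p}{n}} + \frac{16(1+M)^2\sigma^2}{\tau^2}\,\frac{\log p}{n}$$ for all $\beta^*\in\operatorname{argmin}_{\beta\succeq 0}\frac{1}{n}\|X\beta - f\|_2^2$.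
   Context: $X \in \mathbb{R}^{n\times p}$ is a deterministic design matrix with columns $X_1,\dots,X_p$ normalized such that $\|X_j\|_2^2 = n$ for $j=1,\dots,p$. The symbol $\succeq$ denotes componentwise inequality, and $\mathbf{1}$ is the vector of ones. A zero-mean random variable $Z$ is sub-Gaussian with parameter $\sigma>0$ if $\mathbf{E}[\exp(tZ)]\le\exp(\sigma^2t^2/2)$ for all $t\in\mathbb{R}$. Define $$\tau_0 = \max\left\{\tau : \exists w\in\mathbb{R}^n,\ \|w\|_2\le 1,\ \text{such that } \frac{X^\top w}{\sqrt{n}} \succeq \tau\mathbf{1}\right\};$$ equivalently, when $\tau_0 > 0$, $\tau_0^2 = \min\{\lambda^\top\frac1n X^\top X\lambda : \lambda\in\mathbb{R}^p,\ \lambda\succeq 0,\ \mathbf{1}^\top\lambda=1\}$. The design $X$ has the self-regularizing property with constant $\tau>0$ if $\tau_0\ge\tau>0$. *)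

theory Defs
  imports "HOL-Probability.Probability"
begin

text \<open>Matrices of type \<open>real ^ 'p ^ 'n\<close> have \<open>CARD('n)\<close> rows and \<open>CARD('p)\<close> columns.
  The order on vectors is the componentwise one.\<close>

definition l1_norm :: "real ^ 'p \<Rightarrow> real" where
  "l1_norm \<beta> = (\<Sum>j\<in>UNIV. \<bar>\<beta> $ j\<bar>)"

definition mse :: "real ^ 'p ^ 'n \<Rightarrow> real ^ 'n \<Rightarrow> real ^ 'p \<Rightarrow> real" where
  "mse X v \<beta> = (1 / real CARD('n)) * (norm (X *v \<beta> - v))\<^sup>2"

definition nnls_minimizer :: "real ^ 'p ^ 'n \<Rightarrow> real ^ 'n \<Rightarrow> real ^ 'p \<Rightarrow> bool" where
  "nnls_minimizer X v \<beta> \<longleftrightarrow> is_arg_min (mse X v) (\<lambda>\<beta>. 0 \<le> \<beta>) \<beta>"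

text \<open>The minimum is attained, see \<open>nnls_minimizer_exists\<close> and \<open>min_mse_eq\<close>.\<close>

definition min_mse :: "real ^ 'p ^ 'n \<Rightarrow> real ^ 'n \<Rightarrow> real" where
  "min_mse X v = (LEAST e. e \<in> mse X v ` {\<beta>. 0 \<le> \<beta>})"

text \<open>The maximum is attained for every \<open>X\<close>, see \<open>tau0_is_maximum\<close>.\<close>

definition tau0 :: "real ^ 'p ^ 'n \<Rightarrow> real" where
  "tau0 X = (GREATEST \<tau>. \<exists>w. norm w \<le> 1 \<and>
     vec \<tau> \<le> (1 / sqrt (real CARD('n))) *\<^sub>R (transpose X *v w))"

definition self_regularizing :: "real ^ 'p ^ 'n \<Rightarrow> real \<Rightarrow> bool" where
  "self_regularizing X \<tau> \<longleftrightarrow> tau0 X \<ge> \<tau> \<and> \<tau> > 0"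

text \<open>The integral of a non-integrable function is 0 by convention, so the existence of the
  moment generating function is required separately.\<close>

definition sub_gaussian :: "'a measure \<Rightarrow> real \<Rightarrow> ('a \<Rightarrow> real) \<Rightarrow> bool" where
  "sub_gaussian P \<sigma> Z \<longleftrightarrow>
     \<sigma> > 0 \<and> integrable P Z \<and> (\<integral>\<omega>. Z \<omega> \<partial>P) = 0 \<and>
     (\<forall>t. integrable P (\<lambda>\<omega>. exp (t * Z \<omega>)) \<and>
          (\<integral>\<omega>. exp (t * Z \<omega>) \<partial>P) \<le> exp (\<sigma>\<^sup>2 * t\<^sup>2 / 2))"

definition iid :: "'a measure \<Rightarrow> ('i \<Rightarrow> 'a \<Rightarrow> real) \<Rightarrow> bool" where
  "iid P Z \<longleftrightarrow> prob_space.indep_vars P (\<lambda>_. borel) Z UNIV \<and>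
     (\<forall>i j. distr P borel (Z i) = distr P borel (Z j))"

lemma tau0_is_maximum:
  fixes X :: "real ^ 'p ^ 'n"
  shows "\<exists>w. norm w \<le> 1 \<and> vec (tau0 X) \<le> (1 / sqrt (real CARD('n))) *\<^sub>R (transpose X *v w)"
    and "norm w \<le> 1 \<Longrightarrow> vec \<tau> \<le> (1 / sqrt (real CARD('n))) *\<^sub>R (transpose X *v w) \<Longrightarrow> \<tau> \<le> tau0 X"
proof -
  define L :: "real ^ 'n \<Rightarrow> real ^ 'p"
    where "L w = (1 / sqrt (real CARD('n))) *\<^sub>R (transpose X *v w)" for w
  define P where "P \<tau> \<longleftrightarrow> (\<exists>w. norm w \<le> 1 \<and> vec \<tau> \<le> L w)" for \<tau>
  have lin: "linear L"
    unfolding L_def by (intro linear_compose_scale_right matrix_vector_mul_linear)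
  have cont: "continuous_on UNIV (\<lambda>w. L w $ j)" for j
    by (intro continuous_on_component linear_continuous_on linear_conv_bounded_linear[THEN iffD1] lin)
  have contg: "continuous_on UNIV (\<lambda>z::real \<times> (real ^ 'n). L (snd z) $ j)" for j
    by (rule continuous_on_compose2[OF cont continuous_on_snd[OF continuous_on_id]]) auto
  obtain B where B: "\<And>w. norm (L w) \<le> B * norm w" and "B > 0"
    using linear_bounded_pos[OF lin] by blast
  define K where "K = ({0..B} \<times> cball 0 1) \<inter> (\<Inter>j. {z::real \<times> (real ^ 'n). fst z \<le> L (snd z) $ j})"
  have "closed {z::real \<times> (real ^ 'n). fst z \<le> L (snd z) $ j}" for j
    by (intro closed_Collect_le contg continuous_intros)
  then have "compact K"
    unfolding K_def by (intro compact_Int_closed compact_Times closed_INT) auto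
  moreover have K0: "(0, 0) \<in> K"
    using \<open>B > 0\<close> by (simp add: K_def linear_0[OF lin])
  ultimately obtain z :: "real \<times> (real ^ 'n)" where z: "z \<in> K" and zmax: "\<And>u. u \<in> K \<Longrightarrow> fst u \<le> fst z"
    using continuous_attains_sup[of K fst] continuous_on_fst[OF continuous_on_id, of K] by blast
  have Pz: "P (fst z)"
    unfolding P_def using z
    by (intro exI[of _ "snd z"]) (auto simp: K_def less_eq_vec_def)
  have zub: "\<tau> \<le> fst z" if "P \<tau>" for \<tau>
  proof (cases "0 \<le> \<tau>")
    case True
    from that obtain w where w: "norm w \<le> 1" "\<And>j. \<tau> \<le> L w $ j"
      unfolding P_def by (auto simp: less_eq_vec_def)
    have "\<tau> \<le> norm (L w)"
      using w(2) component_le_norm_cart[of "L w"] by (meson abs_ge_self order_trans)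
    also have "\<dots> \<le> B"
      using B[of w] w(1) \<open>B > 0\<close> by (meson less_imp_le mult_left_le order_trans)
    finally show ?thesis
      using zmax[of "(\<tau>, w)"] w True by (auto simp: K_def)
  next
    case False
    then show ?thesis using zmax[OF K0] by simp
  qed
  have tz: "tau0 X = fst z"
    unfolding tau0_def
    by (rule Greatest_equality) (use Pz zub in \<open>auto simp: P_def L_def\<close>)
  show "\<exists>w. norm w \<le> 1 \<and> vec (tau0 X) \<le> (1 / sqrt (real CARD('n))) *\<^sub>R (transpose X *v w)"
    using Pz by (simp add: tz P_def L_def)
  show "\<tau> \<le> tau0 X"
    if "norm w \<le> 1" "vec \<tau> \<le> (1 / sqrt (real CARD('n))) *\<^sub>R (transpose X *v w)"
    using zub[of \<tau>] that by (auto simp: tz P_def L_def)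
qed

lemma nnls_minimizer_exists: "\<exists>\<beta>. nnls_minimizer X v \<beta>"
  for X :: "real ^ 'p ^ 'n"
proof -
  let ?A = "range (\<lambda>j::'p. axis j (1::real))" and ?N = "{\<beta>::real ^ 'p. 0 \<le> \<beta>}"
  have N: "convex_cone hull ?A = ?N"
  proof (rule antisym)
    show "convex_cone hull ?A \<subseteq> ?N"
    proof (rule hull_minimal)
      show "?A \<subseteq> ?N" by (auto simp: less_eq_vec_def axis_def)
      show "convex_cone ?N"
        by (auto simp: convex_cone_def convex_def conic_def less_eq_vec_def intro: exI[of _ 0])
    qed
    show "?N \<subseteq> convex_cone hull ?A"
    proof
      fix \<beta> :: "real ^ 'p" assume "\<beta> \<in> ?N"
      then have nn: "0 \<le> \<beta> $ j" for j by (simp add: less_eq_vec_def)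
      have "(\<Sum>j\<in>J. \<beta> $ j *\<^sub>R axis j (1::real)) \<in> convex_cone hull ?A" if "finite J" for J
        using that
        by induction
          (auto intro!: convex_cone_hull_contains_0 convex_cone_hull_add convex_cone_hull_mul nn
            intro: hull_inc)
      moreover have "(\<Sum>j\<in>UNIV. \<beta> $ j *\<^sub>R axis j (1::real)) = \<beta>"
        by (simp add: vec_eq_iff axis_def if_distrib sum.delta cong: if_cong)
      ultimately show "\<beta> \<in> convex_cone hull ?A" by (metis finite)
    qed
  qed
  have "closed (convex_cone hull ((*v) X ` ?A))"
    by (intro closed_convex_cone_hull finite_imageI) simp
  then have "closed ((*v) X ` ?N)"
    by (simp add: convex_cone_hull_linear_image N)
  moreover have "(*v) X ` ?N \<noteq> {}" by auto
  ultimately obtain u where u: "u \<in> (*v) X ` ?N" "\<And>x. x \<in> (*v) X ` ?N \<Longrightarrow> dist v u \<le> dist v x"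
    using distance_attains_inf by metis
  then obtain \<beta> where "0 \<le> \<beta>" "u = X *v \<beta>" by auto
  moreover have "norm (X *v \<beta> - v) \<le> norm (X *v \<gamma> - v)" if "0 \<le> \<gamma>" for \<gamma>
    using u(2)[of "X *v \<gamma>"] that \<open>u = X *v \<beta>\<close> by (simp add: dist_norm norm_minus_commute)
  ultimately have "nnls_minimizer X v \<beta>"
    by (auto simp: nnls_minimizer_def is_arg_min_linorder mse_def
      intro!: divide_right_mono power_mono)
  then show ?thesis by blast
qed

lemma min_mse_eq: "nnls_minimizer X v \<beta> \<Longrightarrow> min_mse X v = mse X v \<beta>"
  unfolding min_mse_def
  by (rule Least_equality) (auto simp: nnls_minimizer_def is_arg_min_linorder)

end

theory Submission
  imports Defs
begin

text \<open>Comparing the objective at the two minimizers gives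
  \<open>mse X f bhat \<le> mse X f bstar + 2 \<lambda> \<parallel>bhat - bstar\<parallel>\<^sub>1\<close> on the event that every \<open>X\<^sub>j \<bullet> \<epsilon>\<close> has modulus at
  most \<open>n \<lambda>\<close>, which has high probability by Chernoff's bound. The negative part of
  \<open>\<delta> = bhat - bstar\<close> is at most \<open>bstar\<close>. The vector \<open>w\<close> that attains \<open>\<tau>\<^sub>0\<close> has correlation at least
  \<open>\<tau>\<close> and at most 1 with every column, so testing \<open>X \<delta>\<close> against \<open>w\<close> bounds the positive part of
  \<open>\<delta>\<close> by \<open>\<parallel>bstar\<parallel>\<^sub>1\<close> and \<open>\<parallel>X \<delta>\<parallel>\<close>. What remains is a quadratic inequality for the square root of
  \<open>mse X f bhat\<close>.\<close>

section \<open>Sub-Gaussian tails and linear combinations\<close>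

lemma sub_gaussian_uminus: "sub_gaussian P s Z \<Longrightarrow> sub_gaussian P s (\<lambda>\<omega>. - Z \<omega>)"
  unfolding sub_gaussian_def
proof (elim conjE, intro conjI allI)
  fix t
  assume "\<forall>t. integrable P (\<lambda>\<omega>. exp (t * Z \<omega>)) \<and>
    (\<integral>\<omega>. exp (t * Z \<omega>) \<partial>P) \<le> exp (s\<^sup>2 * t\<^sup>2 / 2)"
  from this[rule_format, of "- t"]
  show "integrable P (\<lambda>\<omega>. exp (t * - Z \<omega>))"
    and "(\<integral>\<omega>. exp (t * - Z \<omega>) \<partial>P) \<le> exp (s\<^sup>2 * t\<^sup>2 / 2)"
    by simp_all
qed simp_all

context prob_space
begin

lemma sub_gaussian_upper_tail:
  assumes Z: "sub_gaussian M s Z" and "u > 0"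
  shows "prob {\<omega> \<in> space M. Z \<omega> \<ge> u} \<le> exp (- u\<^sup>2 / (2 * s\<^sup>2))"
proof -
  \<comment> \<open>This \<open>t\<close> minimizes the Chernoff exponent
    \<open>s\<^sup>2 * t\<^sup>2 / 2 - t * u\<close>, whose minimum is
    \<open>- u\<^sup>2 / (2 * s\<^sup>2)\<close>.\<close>
  define t where "t = u / s\<^sup>2"
  have s: "s > 0" and int: "integrable M (\<lambda>\<omega>. exp (t * Z \<omega>))"
    and le: "(\<integral>\<omega>. exp (t * Z \<omega>) \<partial>M) \<le> exp (s\<^sup>2 * t\<^sup>2 / 2)"
    using Z by (auto simp: sub_gaussian_def)
  have "t > 0"
    using s \<open>u > 0\<close> by (simp add: t_def)
  have "prob {\<omega> \<in> space M. Z \<omega> \<ge> u} \<le> exp (- t * u) * (\<integral>\<omega>\<in>space M. exp (t * Z \<omega>) \<partial>M)"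
    using \<open>t > 0\<close> int by (intro Chernoff_ineq_ge) (auto simp: set_integrable_def intro: integrable_mult_indicator[where 'b = real, simplified])
  also have "\<dots> \<le> exp (- t * u) * exp (s\<^sup>2 * t\<^sup>2 / 2)"
    using le int by (simp add: set_integral_space)
  also have "\<dots> = exp (- u\<^sup>2 / (2 * s\<^sup>2))"
    unfolding exp_add[symmetric] using s
    by (simp add: t_def field_simps power2_eq_square)
  finally show ?thesis .
qed

lemma sub_gaussian_tail:
  assumes Z: "sub_gaussian M s Z" and "u > 0"
  shows "prob {\<omega> \<in> space M. \<bar>Z \<omega>\<bar> \<ge> u} \<le> 2 * exp (- u\<^sup>2 / (2 * s\<^sup>2))"
proof -
  have [measurable]: "Z \<in> borel_measurable M"
    using Z by (auto simp: sub_gaussian_def)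
  have "{\<omega> \<in> space M. \<bar>Z \<omega>\<bar> \<ge> u} = {\<omega> \<in> space M. Z \<omega> \<ge> u} \<union> {\<omega> \<in> space M. - Z \<omega> \<ge> u}"
    by auto
  also have "prob \<dots> \<le> prob {\<omega> \<in> space M. Z \<omega> \<ge> u} + prob {\<omega> \<in> space M. - Z \<omega> \<ge> u}"
    by (intro measure_Un_le) measurable
  also have "\<dots> \<le> 2 * exp (- u\<^sup>2 / (2 * s\<^sup>2))"
    using sub_gaussian_upper_tail[OF Z \<open>u > 0\<close>]
      sub_gaussian_upper_tail[OF sub_gaussian_uminus[OF Z] \<open>u > 0\<close>] by simp
  finally show ?thesis .
qed

text \<open>Independence factors the moment generating function over the coordinates. Coordinate
  \<open>i\<close> contributes the exponent \<open>s\<^sup>2 * (t * a $ i)\<^sup>2 / 2\<close>, and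
  summing the squares \<open>(a $ i)\<^sup>2\<close> produces \<open>(norm a)\<^sup>2\<close>. A
  nonzero \<open>a\<close> keeps the new parameter positive.\<close>

lemma sub_gaussian_inner:
  fixes Z :: "'a \<Rightarrow> real ^ 'n" and a :: "real ^ 'n"
  assumes ind: "indep_vars (\<lambda>_. borel) (\<lambda>i \<omega>. Z \<omega> $ i) UNIV"
    and Z: "\<And>i. sub_gaussian M s (\<lambda>\<omega>. Z \<omega> $ i)" and "a \<noteq> 0"
  shows "sub_gaussian M (s * norm a) (\<lambda>\<omega>. a \<bullet> Z \<omega>)"
  unfolding sub_gaussian_def
proof (intro conjI allI)
  have int: "integrable M (\<lambda>\<omega>. Z \<omega> $ i)" and mean: "(\<integral>\<omega>. Z \<omega> $ i \<partial>M) = 0"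
    and int_exp: "integrable M (\<lambda>\<omega>. exp (t * Z \<omega> $ i))"
    and mgf: "(\<integral>\<omega>. exp (t * Z \<omega> $ i) \<partial>M) \<le> exp (s\<^sup>2 * t\<^sup>2 / 2)" for i t
    using Z[of i] by (auto simp: sub_gaussian_def)
  show "s * norm a > 0"
    using Z \<open>a \<noteq> 0\<close> by (simp add: sub_gaussian_def)
  show "integrable M (\<lambda>\<omega>. a \<bullet> Z \<omega>)"
    unfolding inner_vec_def by (simp add: int)
  show "(\<integral>\<omega>. a \<bullet> Z \<omega> \<partial>M) = 0"
    unfolding inner_vec_def by (simp add: int mean)
  fix t
  define Y where "Y i \<omega> = exp (t * a $ i * Z \<omega> $ i)" for i \<omega>
  have exp_inner: "exp (t * (a \<bullet> Z \<omega>)) = (\<Prod>i\<in>UNIV. Y i \<omega>)" for \<omega>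
    by (simp add: Y_def inner_vec_def sum_distrib_left exp_sum mult.assoc)
  have indY: "indep_vars (\<lambda>_. borel) Y UNIV"
    unfolding Y_def by (rule indep_vars_compose2[OF ind]) measurable
  have intY: "integrable M (Y i)" for i
    unfolding Y_def by (rule int_exp)
  show "integrable M (\<lambda>\<omega>. exp (t * (a \<bullet> Z \<omega>)))"
    unfolding exp_inner by (rule indep_vars_integrable) (auto intro: indY intY)
  have "(\<integral>\<omega>. exp (t * (a \<bullet> Z \<omega>)) \<partial>M) = (\<Prod>i\<in>UNIV. \<integral>\<omega>. Y i \<omega> \<partial>M)"
    unfolding exp_inner by (rule indep_vars_lebesgue_integral) (auto intro: indY intY)
  also have "\<dots> \<le> (\<Prod>i\<in>UNIV. exp (s\<^sup>2 * (t * a $ i)\<^sup>2 / 2))"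
    by (intro prod_mono conjI Bochner_Integration.integral_nonneg)
      (simp_all add: Y_def mgf)
  also have "\<dots> = exp ((s * norm a)\<^sup>2 * t\<^sup>2 / 2)"
    by (simp add: exp_sum[symmetric] power_mult_distrib norm_vec_def L2_set_def sum_nonneg
        sum_distrib_left sum_distrib_right sum_divide_distrib mult_ac)
  finally show "(\<integral>\<omega>. exp (t * (a \<bullet> Z \<omega>)) \<partial>M) \<le> exp ((s * norm a)\<^sup>2 * t\<^sup>2 / 2)" .
qed

end

section \<open>The fitted vector as a projection, and its measurability\<close>

lemma nnls_minimizer_norm_le:
  assumes "nnls_minimizer X v \<beta>" "0 \<le> \<gamma>"
  shows "norm (X *v \<beta> - v) \<le> norm (X *v \<gamma> - v)"
proof -
  have "mse X v \<beta> \<le> mse X v \<gamma>"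
    using assms by (auto simp: nnls_minimizer_def is_arg_min_linorder)
  then show ?thesis
    by (simp add: mse_def divide_le_cancel power2_le_iff_abs_le)
qed

lemma nnls_minimizer_nonneg: "nnls_minimizer X v \<beta> \<Longrightarrow> 0 \<le> \<beta>"
  by (simp add: nnls_minimizer_def is_arg_min_def)

lemma convex_nonneg_image: "convex ((*v) X ` {\<beta>. 0 \<le> \<beta>})"
  for X :: "real ^ 'p ^ 'n"
  by (intro convex_linear_image) (auto simp: convex_def less_eq_vec_def)

text \<open>Existence of a minimizer for every target gives closedness: a target in the closure is
  approximated arbitrarily well by the image, so the minimizer for it has residual 0.\<close>

lemma closed_nonneg_image: "closed ((*v) X ` {\<beta>. 0 \<le> \<beta>})"
  for X :: "real ^ 'p ^ 'n"
  unfolding closure_subset_eq[symmetric]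
proof
  fix v assume v: "v \<in> closure ((*v) X ` {\<beta>. 0 \<le> \<beta>})"
  obtain \<beta> where \<beta>: "nnls_minimizer X v \<beta>"
    using nnls_minimizer_exists by blast
  have "norm (X *v \<beta> - v) \<le> e" if "e > 0" for e
  proof -
    obtain \<gamma> where "0 \<le> \<gamma>" "dist (X *v \<gamma>) v < e"
      using v \<open>e > 0\<close> by (auto simp: closure_approachable)
    then show ?thesis
      using nnls_minimizer_norm_le[OF \<beta>, of \<gamma>] by (simp add: dist_norm)
  qed
  then have "X *v \<beta> = v"
    using field_le_epsilon[of "norm (X *v \<beta> - v)" 0] by simp
  then show "v \<in> (*v) X ` {\<beta>. 0 \<le> \<beta>}"
    using nnls_minimizer_nonneg[OF \<beta>] by auto
qed

text \<open>Minimizing coefficients need not be unique, but the nearest point of a closed convex set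
  is. The fit is therefore a function of the target alone, and a continuous one.\<close>

lemma nnls_minimizer_closest_point:
  fixes X :: "real ^ 'p ^ 'n"
  assumes "nnls_minimizer X v \<beta>"
  shows "X *v \<beta> = closest_point ((*v) X ` {\<beta>. 0 \<le> \<beta>}) v"
  using nnls_minimizer_norm_le[OF assms] nnls_minimizer_nonneg[OF assms]
  by (intro closest_point_unique convex_nonneg_image closed_nonneg_image)
    (auto simp: dist_norm norm_minus_commute)

text \<open>The selection \<open>bhat\<close> itself need not be measurable, but the fit is the projection of
  \<open>y\<close> onto a closed convex cone.\<close>

lemma borel_measurable_nnls_fit:
  fixes X :: "real ^ 'p ^ 'n"
  assumes "\<And>\<omega>. \<omega> \<in> space P \<Longrightarrow> nnls_minimizer X (y \<omega>) (bhat \<omega>)" and "y \<in> borel_measurable P"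
  shows "(\<lambda>\<omega>. X *v bhat \<omega>) \<in> borel_measurable P"
proof -
  let ?S = "(*v) X ` {\<beta>. 0 \<le> \<beta>}"
  have "(\<lambda>\<omega>. closest_point ?S (y \<omega>)) \<in> borel_measurable P"
    by (rule borel_measurable_continuous_on[OF continuous_on_closest_point assms(2)])
      (auto intro: convex_nonneg_image closed_nonneg_image)
  then show ?thesis
    using nnls_minimizer_closest_point[OF assms(1)] by (subst measurable_cong) auto
qed

section \<open>The deterministic oracle inequality\<close>

lemma inner_matrix_vector_mult: "v \<bullet> (X *v \<beta>) = (\<Sum>j\<in>UNIV. \<beta> $ j * (column j X \<bullet> v))"
  for X :: "real ^ 'p ^ 'n"
  by (simp add: matrix_mult_sum inner_sum_right inner_commute scalar_mult_eq_scaleR)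

text \<open>The maximum in \<open>tau0\<close> is attained. Clearing the factor
  \<open>1 / sqrt n\<close> makes the correlations comparable with the column norms.\<close>

lemma self_regularizing_witness:
  fixes X :: "real ^ 'p ^ 'n"
  assumes "self_regularizing X \<tau>"
  obtains w where "norm w \<le> 1" "\<And>j. \<tau> * sqrt (real CARD('n)) \<le> column j X \<bullet> w"
proof -
  obtain w where w: "norm w \<le> 1"
    "vec (tau0 X) \<le> (1 / sqrt (real CARD('n))) *\<^sub>R (transpose X *v w)"
    using tau0_is_maximum(1) by blast
  have "tau0 X \<le> (column j X \<bullet> w) / sqrt (real CARD('n))" for j
    using w(2) by (simp add: less_eq_vec_def vector_matrix_mult_def column_def inner_vec_def mult.commute)
  moreover have "\<tau> \<le> tau0 X"
    using assms by (simp add: self_regularizing_def)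
  ultimately have "\<tau> * sqrt (real CARD('n)) \<le> column j X \<bullet> w" for j
    by (meson order_trans pos_le_divide_eq real_sqrt_gt_zero of_nat_0_less_iff zero_less_card_finite)
  with w(1) show thesis by (rule that)
qed

text \<open>Pairing \<open>X *v (\<beta> - \<gamma>)\<close> with the witness \<open>w\<close>
  weights coordinate \<open>j\<close> by \<open>column j X \<bullet> w\<close>, which lies between
  \<open>\<tau> * r\<close> and, by Cauchy-Schwarz, \<open>r\<close>. A nonnegative coordinate of
  the difference thus gains at least \<open>\<tau> * r\<close> times its size; a negative one has
  size at most \<open>\<gamma> $ j\<close>. The two bounds on the weight also squeeze
  \<open>\<tau>\<close> below 1.\<close>

lemma l1_norm_diff_le:
  fixes X :: "real ^ 'p ^ 'n"
  assumes col: "\<And>j. norm (column j X) = sqrt (real CARD('n))"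
    and reg: "self_regularizing X \<tau>" and "0 \<le> \<beta>" "0 \<le> \<gamma>"
  shows "\<tau> * l1_norm (\<beta> - \<gamma>) \<le> norm (X *v (\<beta> - \<gamma>)) / sqrt (real CARD('n)) + 2 * l1_norm \<gamma>"
    and "\<tau> \<le> 1"
proof -
  define r where "r = sqrt (real CARD('n))"
  have "r > 0" by (simp add: r_def)
  obtain w where w: "norm w \<le> 1" and lb: "\<And>j. \<tau> * r \<le> column j X \<bullet> w"
    using self_regularizing_witness[OF reg] unfolding r_def by blast
  have ub: "column j X \<bullet> w \<le> r" for j
    using norm_cauchy_schwarz[of "column j X" w] mult_left_le[OF w, of r] \<open>r > 0\<close>
    unfolding col r_def[symmetric] by linarith
  have "\<tau> > 0" using reg by (simp add: self_regularizing_def)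
  show "\<tau> \<le> 1"
    using order_trans[OF lb ub] \<open>r > 0\<close> by simp
  have coord: "\<tau> * r * \<bar>\<beta> $ j - \<gamma> $ j\<bar> \<le> (\<beta> $ j - \<gamma> $ j) * (column j X \<bullet> w) + 2 * r * \<bar>\<gamma> $ j\<bar>" for j
  proof (cases "\<gamma> $ j \<le> \<beta> $ j")
    case True
    then have "\<tau> * r * \<bar>\<beta> $ j - \<gamma> $ j\<bar> \<le> (\<beta> $ j - \<gamma> $ j) * (column j X \<bullet> w)"
      using mult_left_mono[OF lb[of j], of "\<beta> $ j - \<gamma> $ j"] by (simp add: mult_ac)
    moreover have "0 \<le> 2 * r * \<bar>\<gamma> $ j\<bar>" using \<open>r > 0\<close> by simp
    ultimately show ?thesis by linarith
  next
    case False
    have "0 \<le> \<beta> $ j" using \<open>0 \<le> \<beta>\<close> by (simp add: less_eq_vec_def)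
    \<comment> \<open>Source of the factor 2: one copy of \<open>r * d\<close> covers the left-hand
      side, as \<open>\<tau> \<le> 1\<close>, and a second offsets the term
      \<open>- d * (column j X \<bullet> w)\<close>.\<close>
    define d where "d = \<gamma> $ j - \<beta> $ j"
    have d: "0 \<le> d" "d \<le> \<bar>\<gamma> $ j\<bar>" using False \<open>0 \<le> \<beta> $ j\<close> by (auto simp: d_def)
    have "\<tau> * r * d \<le> r * d"
      using d \<open>r > 0\<close> \<open>\<tau> \<le> 1\<close> \<open>\<tau> > 0\<close> by (intro mult_right_mono) auto
    moreover have "d * (column j X \<bullet> w) \<le> d * r"
      using d ub by (intro mult_left_mono) auto
    moreover have "r * d \<le> r * \<bar>\<gamma> $ j\<bar>"
      using d \<open>r > 0\<close> by (intro mult_left_mono) auto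
    moreover have "\<bar>\<beta> $ j - \<gamma> $ j\<bar> = d" "\<beta> $ j - \<gamma> $ j = - d" using False by (auto simp: d_def)
    ultimately show ?thesis by (simp add: mult_ac)
  qed
  have "\<tau> * r * l1_norm (\<beta> - \<gamma>) \<le> w \<bullet> (X *v (\<beta> - \<gamma>)) + 2 * r * l1_norm \<gamma>"
    unfolding l1_norm_def inner_matrix_vector_mult sum_distrib_left sum.distrib[symmetric]
    by (intro sum_mono) (use coord in simp)
  also have "w \<bullet> (X *v (\<beta> - \<gamma>)) \<le> norm (X *v (\<beta> - \<gamma>))"
    using norm_cauchy_schwarz[of w "X *v (\<beta> - \<gamma>)"] w
      mult_right_mono[of "norm w" 1 "norm (X *v (\<beta> - \<gamma>))"] by simp
  finally show "\<tau> * l1_norm (\<beta> - \<gamma>) \<le> norm (X *v (\<beta> - \<gamma>)) / sqrt (real CARD('n)) + 2 * l1_norm \<gamma>"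
    using \<open>r > 0\<close> unfolding r_def[symmetric] by (simp add: field_simps)
qed

text \<open>Optimality of \<open>bhat\<close> for the noisy target is compared with
  \<open>b\<close>. When both squared residuals are expanded around \<open>f\<close>, the term
  \<open>e \<bullet> e\<close> cancels and only the cross term survives.\<close>

lemma mse_basic_inequality:
  fixes X :: "real ^ 'p ^ 'n"
  assumes bhat: "nnls_minimizer X (f + e) bhat" and "0 \<le> b"
  shows "mse X f bhat \<le> mse X f b + 2 / real CARD('n) * (e \<bullet> (X *v (bhat - b)))"
proof -
  have "(norm (X *v bhat - (f + e)))\<^sup>2 \<le> (norm (X *v b - (f + e)))\<^sup>2"
    using nnls_minimizer_norm_le[OF assms] by simp
  then have "(norm (X *v bhat - f))\<^sup>2 \<le> (norm (X *v b - f))\<^sup>2 + 2 * (e \<bullet> (X *v (bhat - b)))"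
    by (simp add: power2_norm_eq_inner algebra_simps inner_commute matrix_vector_mult_diff_distrib)
  then show ?thesis
    by (simp add: mse_def field_simps)
qed

text \<open>The hypothesis first yields the crude bound \<open>x \<le> 3 * m + a + B\<close>;
  inserting it for the linear occurrence of \<open>x\<close> gives the conclusion. Here
  \<open>x\<close> and \<open>a\<close> stand for the roots of the two errors, \<open>B\<close> for
  the l1 norm of the comparison vector and \<open>m\<close> for the noise level over
  \<open>\<tau>\<close>.\<close>

lemma quadratic_bound:
  fixes x a m B :: real
  assumes le: "x\<^sup>2 \<le> a\<^sup>2 + 2 * m * (2 * B + x + a)" and "0 \<le> a" "0 \<le> m" "0 \<le> B"
  shows "x\<^sup>2 \<le> a\<^sup>2 + (6 * B + 4 * a) * m + 6 * m\<^sup>2"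
proof -
  have "x \<le> 3 * m + a + B"
  proof (rule ccontr)
    assume "\<not> ?thesis"
    then have x: "x > 3 * m + a + B" by simp
    then have "(3 * m + a + B) * (m + a + B) \<le> x * (x - 2 * m)"
      using assms by (intro mult_mono) auto
    moreover have "(3 * m + a + B) * (m + a + B) =
        a\<^sup>2 + 2 * m * (2 * B + a) + (3 * m\<^sup>2 + 2 * a * m + 2 * a * B + B\<^sup>2)"
      by (simp add: power2_eq_square algebra_simps)
    moreover have "0 \<le> 2 * a * m" "0 \<le> 2 * a * B" "0 \<le> B\<^sup>2" "0 \<le> m\<^sup>2"
      using assms by auto
    moreover have "x * (x - 2 * m) \<le> a\<^sup>2 + 2 * m * (2 * B + a)"
      using le by (simp add: power2_eq_square algebra_simps)
    \<comment> \<open>The product comparison is not strict, so it only forces the nonnegative slack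
      to vanish. The remaining case \<open>m = 0\<close> contradicts \<open>x > a\<close>.\<close>
    ultimately have "m\<^sup>2 = 0"
      using zero_le_power2[of B] by linarith
    then have "x\<^sup>2 \<le> a\<^sup>2" "x > a"
      using le x \<open>0 \<le> B\<close> by auto
    then show False
      using \<open>0 \<le> a\<close> power_strict_mono[of a x 2] by simp
  qed
  then have "2 * m * (2 * B + x + a) \<le> 2 * m * (2 * B + (3 * m + a + B) + a)"
    using \<open>0 \<le> m\<close> by (intro mult_left_mono) auto
  then show ?thesis
    using le by (simp add: power2_eq_square algebra_simps)
qed

text \<open>By l1/sup-norm duality the cross term of the basic inequality is at most
  \<open>l\<close> times the l1 norm of \<open>bhat - b\<close>, up to the factor 2. Bounding that
  norm through self-regularization costs \<open>1 / \<tau>\<close>, hence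
  \<open>m = l / \<tau>\<close>, and leaves the quadratic inequality in \<open>x\<close>.\<close>

lemma nnls_oracle_inequality:
  fixes X :: "real ^ 'p ^ 'n"
  assumes col: "\<And>j. norm (column j X) = sqrt (real CARD('n))"
    and reg: "self_regularizing X \<tau>"
    and bhat: "nnls_minimizer X (f + e) bhat" and "0 \<le> b" and "0 \<le> l"
    and noise: "\<And>j. \<bar>column j X \<bullet> e\<bar> \<le> real CARD('n) * l"
  shows "mse X f bhat \<le> mse X f b + (6 * l1_norm b + 8 * sqrt (mse X f b)) / \<tau>\<^sup>2 * l + 8 * l\<^sup>2 / \<tau>\<^sup>2"
proof -
  define n where "n = real CARD('n)"
  define x where "x = norm (X *v bhat - f) / sqrt n"
  define a where "a = norm (X *v b - f) / sqrt n"
  define B where "B = l1_norm b"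
  define m where "m = l / \<tau>"
  have "n > 0" by (simp add: n_def)
  have \<tau>: "0 < \<tau>" "\<tau> \<le> 1"
    using reg l1_norm_diff_le(2)[OF col reg \<open>0 \<le> b\<close> \<open>0 \<le> b\<close>] by (auto simp: self_regularizing_def)
  have nn: "0 \<le> x" "0 \<le> a" "0 \<le> B" "0 \<le> m"
    using \<open>n > 0\<close> \<tau> \<open>0 \<le> l\<close> by (auto simp: x_def a_def B_def m_def l1_norm_def sum_nonneg)
  have mse: "mse X f bhat = x\<^sup>2" "mse X f b = a\<^sup>2"
    using \<open>n > 0\<close> by (simp_all add: mse_def x_def a_def n_def power_divide)
  have "norm (X *v (bhat - b)) \<le> norm (X *v bhat - f) + norm (X *v b - f)"
    using norm_triangle_ineq4[of "X *v bhat - f" "X *v b - f"] by (simp add: algebra_simps)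
  then have "norm (X *v (bhat - b)) / sqrt n \<le> x + a"
    using \<open>n > 0\<close> by (simp add: x_def a_def add_divide_distrib[symmetric] divide_right_mono)
  then have l1: "\<tau> * l1_norm (bhat - b) \<le> x + a + 2 * B"
    using l1_norm_diff_le(1)[OF col reg nnls_minimizer_nonneg[OF bhat] \<open>0 \<le> b\<close>]
    by (simp add: n_def B_def)
  have "e \<bullet> (X *v (bhat - b)) \<le> (\<Sum>j\<in>UNIV. \<bar>(bhat - b) $ j\<bar> * (n * l))"
    unfolding inner_matrix_vector_mult
  proof (rule sum_mono)
    fix j
    have "(bhat - b) $ j * (column j X \<bullet> e) \<le> \<bar>(bhat - b) $ j\<bar> * \<bar>column j X \<bullet> e\<bar>"
      by (metis abs_ge_self abs_mult)
    also have "\<dots> \<le> \<bar>(bhat - b) $ j\<bar> * (n * l)"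
      using noise by (intro mult_left_mono) (auto simp: n_def)
    finally show "(bhat - b) $ j * (column j X \<bullet> e) \<le> \<bar>(bhat - b) $ j\<bar> * (n * l)" .
  qed
  then have "2 / n * (e \<bullet> (X *v (bhat - b))) \<le> 2 / n * (n * l * l1_norm (bhat - b))"
    using \<open>n > 0\<close> by (intro mult_left_mono) (auto simp: l1_norm_def sum_distrib_right mult_ac sum_distrib_left)
  also have "\<dots> = 2 * m * (\<tau> * l1_norm (bhat - b))"
    using \<open>n > 0\<close> \<tau> by (simp add: m_def)
  also have "\<dots> \<le> 2 * m * (x + a + 2 * B)"
    using l1 nn by (intro mult_left_mono) auto
  finally have "x\<^sup>2 \<le> a\<^sup>2 + 2 * m * (2 * B + x + a)"
    using mse_basic_inequality[OF bhat \<open>0 \<le> b\<close>] by (simp add: mse n_def add_ac)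
  then have "x\<^sup>2 \<le> a\<^sup>2 + (6 * B + 4 * a) * m + 6 * m\<^sup>2"
    using nn by (intro quadratic_bound)
  also have "m\<^sup>2 = l\<^sup>2 / \<tau>\<^sup>2"
    by (simp add: m_def power_divide)
  \<comment> \<open>Here 4 is relaxed to 8, and \<open>l / \<tau>\<close> to
    \<open>l / \<tau>\<^sup>2\<close> because \<open>\<tau> \<le> 1\<close>.\<close>
  also have "(6 * B + 4 * a) * m \<le> (6 * B + 8 * a) * (l / \<tau>\<^sup>2)"
  proof (intro mult_mono)
    show "m \<le> l / \<tau>\<^sup>2"
      unfolding m_def using \<tau> \<open>0 \<le> l\<close>
      by (intro divide_left_mono) (auto simp: power2_eq_square mult_left_le)
  qed (use nn in auto)
  also have "6 * (l\<^sup>2 / \<tau>\<^sup>2) \<le> 8 * l\<^sup>2 / \<tau>\<^sup>2"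
    by (simp add: divide_right_mono)
  finally show ?thesis
    using nn by (simp add: mse B_def)
qed

section \<open>The noise event and the probability bound\<close>

lemma (in prob_space) sub_gaussian_columns_tail:
  fixes X :: "real ^ 'p ^ 'n" and Z :: "'a \<Rightarrow> real ^ 'n"
  assumes ind: "indep_vars (\<lambda>_. borel) (\<lambda>i \<omega>. Z \<omega> $ i) UNIV"
    and Z: "\<And>i. sub_gaussian M s (\<lambda>\<omega>. Z \<omega> $ i)"
    and col: "\<And>j. norm (column j X) = sqrt (real CARD('n))" and "l > 0"
  shows "prob {\<omega> \<in> space M. \<exists>j. \<bar>column j X \<bullet> Z \<omega>\<bar> \<ge> real CARD('n) * l}
    \<le> 2 * real CARD('p) * exp (- real CARD('n) * l\<^sup>2 / (2 * s\<^sup>2))"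
proof -
  define E where "E j = {\<omega> \<in> space M. \<bar>column j X \<bullet> Z \<omega>\<bar> \<ge> real CARD('n) * l}" for j
  have sg: "sub_gaussian M (s * sqrt (real CARD('n))) (\<lambda>\<omega>. column j X \<bullet> Z \<omega>)" for j
    using sub_gaussian_inner[OF ind Z, of "column j X"] col[of j] by force
  have [measurable]: "(\<lambda>\<omega>. column j X \<bullet> Z \<omega>) \<in> borel_measurable M" for j
    using sg[of j] by (auto simp: sub_gaussian_def)
  \<comment> \<open>With threshold \<open>n * l\<close> and parameter \<open>s * sqrt n\<close>, one
    factor of \<open>n\<close> cancels in the exponent.\<close>
  have "prob (E j) \<le> 2 * exp (- (real CARD('n) * l)\<^sup>2 / (2 * (s * sqrt (real CARD('n)))\<^sup>2))" for j
    unfolding E_def using \<open>l > 0\<close> by (intro sub_gaussian_tail sg) simp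
  then have E: "prob (E j) \<le> 2 * exp (- real CARD('n) * l\<^sup>2 / (2 * s\<^sup>2))" for j
    by (simp add: power_mult_distrib power2_eq_square mult_ac)
  have "{\<omega> \<in> space M. \<exists>j. \<bar>column j X \<bullet> Z \<omega>\<bar> \<ge> real CARD('n) * l} = (\<Union>j\<in>UNIV. E j)"
    by (auto simp: E_def)
  also have "prob \<dots> \<le> (\<Sum>j\<in>UNIV. prob (E j))"
    by (intro finite_measure_subadditive_finite) (auto simp: E_def)
  also have "\<dots> \<le> real CARD('p) * (2 * exp (- real CARD('n) * l\<^sup>2 / (2 * s\<^sup>2)))"
    using E by (intro sum_bounded_above)
  finally show ?thesis by (simp add: mult_ac)
qed

theorem theorem1:
  fixes X :: "real ^ 'p ^ 'n"
    and f :: "real ^ 'n"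
    and P :: "'w measure"
    and \<epsilon> y :: "'w \<Rightarrow> real ^ 'n"
    and bhat :: "'w \<Rightarrow> real ^ 'p"
    and \<sigma> \<tau> M :: real
  assumes "prob_space P"
    and "\<And>j. (norm (column j X))\<^sup>2 = real CARD('n)"
    and "iid P (\<lambda>i \<omega>. \<epsilon> \<omega> $ i)"
    and "\<And>i. sub_gaussian P \<sigma> (\<lambda>\<omega>. \<epsilon> \<omega> $ i)"
    and "\<And>\<omega>. \<omega> \<in> space P \<Longrightarrow> y \<omega> = f + \<epsilon> \<omega>"
    and "self_regularizing X \<tau>"
    and "\<And>\<omega>. \<omega> \<in> space P \<Longrightarrow> nnls_minimizer X (y \<omega>) (bhat \<omega>)"
    and "M \<ge> 0"
  shows "measure P {\<omega> \<in> space P.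
            \<forall>bstar. nnls_minimizer X f bstar \<longrightarrow>
              mse X f (bhat \<omega>) \<le> min_mse X f
                + ((6 * l1_norm bstar + 8 * sqrt (min_mse X f)) / \<tau>\<^sup>2)
                    * (1 + M) * \<sigma> * sqrt (2 * ln (real CARD('p)) / real CARD('n))
                + (16 * (1 + M)\<^sup>2 * \<sigma>\<^sup>2 / \<tau>\<^sup>2) * (ln (real CARD('p)) / real CARD('n))}
         \<ge> 1 - 2 * real CARD('p) powr (- (M\<^sup>2))"
proof (cases "CARD('p) = 1")
  \<comment> \<open>For \<open>p = 1\<close> the noise level \<open>l\<close> chosen below would be
    0, but the claimed lower bound is then \<open>-1\<close>.\<close>
  case True
  then have "1 - 2 * real CARD('p) powr (- (M\<^sup>2)) \<le> 0" by simp
  then show ?thesis by (rule order_trans) (rule measure_nonneg)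
next
  case False
  interpret prob_space P by fact
  let ?n = "real CARD('n)" and ?p = "real CARD('p)"
  have p: "?p > 1"
    using False zero_less_card_finite[where 'a = 'p] by linarith
  \<comment> \<open>Chosen so that the tail exponent
    \<open>n * l\<^sup>2 / (2 * \<sigma>\<^sup>2)\<close> equals
    \<open>(1 + M)\<^sup>2 * ln p\<close>.\<close>
  define l where "l = (1 + M) * \<sigma> * sqrt (2 * ln ?p / ?n)"
  have "\<sigma> > 0"
    using assms(4) by (simp add: sub_gaussian_def)
  then have "l > 0"
    using p \<open>M \<ge> 0\<close> by (simp add: l_def)
  have l2: "l\<^sup>2 = (1 + M)\<^sup>2 * \<sigma>\<^sup>2 * (2 * ln ?p / ?n)"
    using p by (simp add: l_def power_mult_distrib)
  have col: "norm (column j X) = sqrt ?n" for j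
    using assms(2)[of j] by (metis norm_ge_zero real_sqrt_unique)
  have ind: "indep_vars (\<lambda>_. borel) (\<lambda>i \<omega>. \<epsilon> \<omega> $ i) UNIV"
    using assms(3) by (simp add: iid_def)
  have [measurable]: "\<epsilon> \<in> borel_measurable P"
    using ind by (subst borel_measurable_euclidean_space)
      (auto simp: Basis_vec_def inner_axis indep_vars_def)
  have y: "y \<in> borel_measurable P"
    using assms(5) by (subst measurable_cong[of _ _ "\<lambda>\<omega>. f + \<epsilon> \<omega>"]) auto
  have [measurable]: "(\<lambda>\<omega>. X *v bhat \<omega>) \<in> borel_measurable P"
    using assms(7) y by (rule borel_measurable_nnls_fit)
  have [measurable]: "(\<lambda>\<omega>. mse X f (bhat \<omega>)) \<in> borel_measurable P"
    unfolding mse_def by measurable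
  define g where "g b = min_mse X f + ((6 * l1_norm b + 8 * sqrt (min_mse X f)) / \<tau>\<^sup>2)
      * (1 + M) * \<sigma> * sqrt (2 * ln ?p / ?n) + (16 * (1 + M)\<^sup>2 * \<sigma>\<^sup>2 / \<tau>\<^sup>2) * (ln ?p / ?n)" for b :: "real ^ 'p"
  \<comment> \<open>The constant 16 is 8 times the factor 2 inside \<open>l\<^sup>2\<close>.\<close>
  have g: "g b = mse X f b + (6 * l1_norm b + 8 * sqrt (mse X f b)) / \<tau>\<^sup>2 * l + 8 * l\<^sup>2 / \<tau>\<^sup>2"
    if "nnls_minimizer X f b" for b
    unfolding g_def min_mse_eq[OF that] l2 by (simp add: l_def mult.assoc)
  define A where "A = {\<omega> \<in> space P. \<forall>b. nnls_minimizer X f b \<longrightarrow> mse X f (bhat \<omega>) \<le> g b}"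
  define N where "N = {\<omega> \<in> space P. \<exists>j. \<bar>column j X \<bullet> \<epsilon> \<omega>\<bar> \<ge> ?n * l}"
  have N: "N \<in> events"
    unfolding N_def by measurable
  \<comment> \<open>There may be uncountably many minimizers \<open>b\<close>, so \<open>A\<close>
    is treated as the preimage of one closed set rather than as an intersection of events.\<close>
  have "closed (\<Inter>b\<in>Collect (nnls_minimizer X f). {..g b})"
    by blast
  moreover have "A = (\<lambda>\<omega>. mse X f (bhat \<omega>)) -` (\<Inter>b\<in>Collect (nnls_minimizer X f). {..g b}) \<inter> space P"
    by (auto simp: A_def)
  ultimately have A: "A \<in> events"
    by (metis \<open>(\<lambda>\<omega>. mse X f (bhat \<omega>)) \<in> borel_measurable P\<close> borel_closed measurable_sets)
  have sub: "space P - N \<subseteq> A"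
  proof
    fix \<omega> assume \<omega>: "\<omega> \<in> space P - N"
    have "mse X f (bhat \<omega>) \<le> g b" if "nnls_minimizer X f b" for b
      unfolding g[OF that]
    proof (rule nnls_oracle_inequality[OF col assms(6)])
      show "nnls_minimizer X (f + \<epsilon> \<omega>) (bhat \<omega>)"
        using assms(5,7) \<omega> by force
      show "\<bar>column j X \<bullet> \<epsilon> \<omega>\<bar> \<le> ?n * l" for j
        using \<omega> by (auto simp: N_def not_le intro: less_imp_le)
    qed (use that nnls_minimizer_nonneg \<open>l > 0\<close> in auto)
    with \<omega> show "\<omega> \<in> A" by (auto simp: A_def)
  qed
  have "prob N \<le> 2 * ?p * exp (- ?n * l\<^sup>2 / (2 * \<sigma>\<^sup>2))"
    unfolding N_def using ind assms(4) col \<open>l > 0\<close> by (rule sub_gaussian_columns_tail)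
  also have "- ?n * l\<^sup>2 / (2 * \<sigma>\<^sup>2) = - ((1 + M)\<^sup>2 * ln ?p)"
    using \<open>\<sigma> > 0\<close> by (simp add: l2)
  \<comment> \<open>The factor \<open>p\<close> of the union bound costs one power of
    \<open>p\<close>. What remains suffices because
    \<open>(1 + M)\<^sup>2 - 1 = M\<^sup>2 + 2 * M \<ge> M\<^sup>2\<close>.\<close>
  also have "2 * ?p * exp (- ((1 + M)\<^sup>2 * ln ?p)) = 2 * ?p powr (1 - (1 + M)\<^sup>2)"
    using p by (simp add: powr_def exp_diff exp_minus left_diff_distrib field_simps)
  also have "\<dots> \<le> 2 * ?p powr (- (M\<^sup>2))"
    using p \<open>M \<ge> 0\<close> by (intro mult_left_mono powr_mono) (auto simp: power2_eq_square algebra_simps)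
  finally have "1 - 2 * ?p powr (- (M\<^sup>2)) \<le> 1 - prob N"
    by simp
  also have "\<dots> = prob (space P - N)"
    using N by (simp add: prob_compl)
  also have "\<dots> \<le> prob A"
    using sub A by (rule finite_measure_mono)
  finally show ?thesis
    by (simp add: A_def g_def)
qed

end
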